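(* A retract of a well-filtered determined space is well-filtered determined: if $X$ is a well-filtered determined $T_0$ space, $Y$ is a $T_0$ space, and there are continuous maps $f:X\to Y$ and $g:Y\to X$ with $f\circ g=\mathrm{id}_Y$, then $Y$ is well-filtered determined.
   Context: For a $T_0$ space $Z$, the specialization order is $x\le y$ iff $x\in\overline{\{y\}}$, and $\mathsf{K}(Z)$ is the set of nonempty compact saturated subsets (saturated = upper set in the specialization order). A family $\mathcal K\subseteq \mathsf K(Z)$ is filtered if it is nonempty and for all $K_1,K_2\in\mathcal K$ there is $K_3\in\mathcal K$ with $K_3\subseteq K_1\cap K_2$. $Z$ is well-filtered if it is $T_0$ and for every open $U\subseteq Z$ and every filtered family $\mathcal K\subseteq\mathsf K(Z)$, $\bigcap\mathcal K\subseteq U$ implies $K\subseteq U$ for some $K\in\mathcal K$. A nonempty subset $A$ of a space is irreducible if whenever $A\subseteq F_1\cup F_2$ with $F_1,F_2$ closed, then $A\subseteq F_1$ or $A\subseteq F_2$. A subset $A$ of a $T_0$ space $X$ is well-filtered determined if for every continuous map $h:X\to Z$ to a well-filtered space $Z$ there is a unique $z_A\in Z$ with $\overline{h(A)}=\overline{\{z_A\}}$. A $T_0$ space $X$ is well-filtered determined if every irreducible closed subset of $X$ is well-filtered determined. *)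

theory Defs
  imports "HOL-Analysis.Analysis"
begin

definition specialization_le :: "'a topology \<Rightarrow> 'a \<Rightarrow> 'a \<Rightarrow> bool" where
  "specialization_le X x y \<longleftrightarrow> x \<in> topspace X \<and> y \<in> topspace X \<and> x \<in> X closure_of {y}"

definition saturatedin :: "'a topology \<Rightarrow> 'a set \<Rightarrow> bool" where
  "saturatedin X S \<longleftrightarrow>
     S \<subseteq> topspace X \<and> (\<forall>x y. x \<in> S \<longrightarrow> specialization_le X x y \<longrightarrow> y \<in> S)"

definition compact_saturated_sets :: "'a topology \<Rightarrow> 'a set set" where
  "compact_saturated_sets X = {K. K \<noteq> {} \<and> compactin X K \<and> saturatedin X K}"

definition filtered_family :: "'a set set \<Rightarrow> bool" where
  "filtered_family \<K> \<longleftrightarrow>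
     \<K> \<noteq> {} \<and> (\<forall>K1\<in>\<K>. \<forall>K2\<in>\<K>. \<exists>K3\<in>\<K>. K3 \<subseteq> K1 \<inter> K2)"

definition well_filtered_space :: "'a topology \<Rightarrow> bool" where
  "well_filtered_space Z \<longleftrightarrow>
     t0_space Z \<and>
     (\<forall>U \<K>. openin Z U \<longrightarrow> \<K> \<subseteq> compact_saturated_sets Z \<longrightarrow> filtered_family \<K> \<longrightarrow>
        \<Inter>\<K> \<subseteq> U \<longrightarrow> (\<exists>K\<in>\<K>. K \<subseteq> U))"

definition irreduciblein :: "'a topology \<Rightarrow> 'a set \<Rightarrow> bool" where
  "irreduciblein X A \<longleftrightarrow>
     A \<subseteq> topspace X \<and> A \<noteq> {} \<and>
     (\<forall>F1 F2. closedin X F1 \<longrightarrow> closedin X F2 \<longrightarrow> A \<subseteq> F1 \<union> F2 \<longrightarrow> A \<subseteq> F1 \<or> A \<subseteq> F2)"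

text \<open>
  The target space Z should range over all well-filtered spaces. HOL cannot quantify over types
  inside a formula, so Z ranges over the spaces whose points have type \<^typ>\<open>'a set\<close>. This is no
  restriction: by theorem \<open>well_filtered_determinedinD\<close> below, a set that passes the test
  for these spaces passes it for the well-filtered spaces over every type.
\<close>

definition well_filtered_determinedin :: "'a topology \<Rightarrow> 'a set \<Rightarrow> bool" where
  "well_filtered_determinedin X A \<longleftrightarrow>
     A \<subseteq> topspace X \<and>
     (\<forall>(Z :: 'a set topology) h. well_filtered_space Z \<longrightarrow> continuous_map X Z h \<longrightarrow>
        (\<exists>!z. z \<in> topspace Z \<and> Z closure_of (h ` A) = Z closure_of {z}))"

definition well_filtered_determined_space :: "'a topology \<Rightarrow> bool" where
  "well_filtered_determined_space X \<longleftrightarrow>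
     t0_space X \<and>
     (\<forall>A. closedin X A \<longrightarrow> irreduciblein X A \<longrightarrow> well_filtered_determinedin X A)"


subsection \<open>Independence of the type of the target spaces\<close>

text \<open>
  Every continuous map h from X to a well-filtered space Z corestricts to the closure B of its
  image in the Skula topology of Z. The subspace B is well-filtered, and a point z of B is
  determined by the set of those x with h x below z; hence B is homeomorphic to a space
  on \<^typ>\<open>'a set\<close>.
\<close>

lemma closure_of_singleton_trans:
  assumes "x \<in> Z closure_of {y}" "y \<in> Z closure_of {z}"
  shows "x \<in> Z closure_of {z}"
  using assms by (auto simp: in_closure_of)

lemma t0_space_closure_of_eqD:
  assumes "t0_space Z" "x \<in> topspace Z" "y \<in> topspace Z" "Z closure_of {x} = Z closure_of {y}"
  shows "x = y"
proof (rule ccontr)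
  assume "x \<noteq> y"
  then obtain U where U: "openin Z U" "x \<notin> U \<longleftrightarrow> y \<in> U"
    using assms(1-3) unfolding t0_space_def by blast
  have "x \<in> Z closure_of {x}" "y \<in> Z closure_of {y}"
    using assms(2,3) by (auto simp: in_closure_of)
  then have "x \<in> Z closure_of {y}" "y \<in> Z closure_of {x}"
    using assms(4) by auto
  then show False using U by (auto simp: in_closure_of)
qed

lemma well_filtered_subtopology:
  assumes wf: "well_filtered_space Z" and BZ: "B \<subseteq> topspace Z"
    and skula: "\<And>z. z \<in> Z closure_of (B \<inter> Z closure_of {z}) \<Longrightarrow> z \<in> B"
  shows "well_filtered_space (subtopology Z B)"
  unfolding well_filtered_space_def
proof (intro conjI allI impI)
  show "t0_space (subtopology Z B)"
    using wf by (simp add: well_filtered_space_def t0_space_subtopology)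
next
  fix U \<K>
  assume U: "openin (subtopology Z B) U" and \<K>: "\<K> \<subseteq> compact_saturated_sets (subtopology Z B)"
    and filt: "filtered_family \<K>" and sub: "\<Inter>\<K> \<subseteq> U"
  obtain U0 where U0: "openin Z U0" "U = U0 \<inter> B"
    using U by (auto simp: openin_subtopology)
  have K: "compactin Z K" "K \<subseteq> B" "K \<noteq> {}" "saturatedin (subtopology Z B) K" if "K \<in> \<K>" for K
    using that \<K> by (auto simp: compact_saturated_sets_def compactin_subtopology)
  show "\<exists>K\<in>\<K>. K \<subseteq> U"
  proof (rule ccontr)
    assume none: "\<not> (\<exists>K\<in>\<K>. K \<subseteq> U)"
    define VV where "VV = {V. openin Z V \<and> U0 \<subseteq> V \<and> (\<forall>K\<in>\<K>. \<not> K \<subseteq> V)}"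
    have U0VV: "U0 \<in> VV"
      using none K(2) U0 by (auto simp: VV_def)
    have "\<exists>M\<in>VV. \<forall>V\<in>VV. M \<subseteq> V \<longrightarrow> V = M"
    proof (rule subset_Zorn_nonempty)
      show "VV \<noteq> {}" using U0VV by blast
      fix \<C> assume ne: "\<C> \<noteq> {}" and ch: "subset.chain VV \<C>"
      have CV: "\<C> \<subseteq> VV" using ch by (simp add: subset.chain_def)
      have "\<not> K \<subseteq> \<Union>\<C>" if "K \<in> \<K>" for K
      proof
        have compK: "compactin Z K" using K(1)[OF that] .
        assume "K \<subseteq> \<Union>\<C>"
        moreover have "\<forall>V\<in>\<C>. openin Z V" using CV by (auto simp: VV_def)
        ultimately obtain \<F> where F: "finite \<F>" "\<F> \<subseteq> \<C>" "K \<subseteq> \<Union>\<F>"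
          using compK unfolding compactin_def by meson
        have "\<F> \<noteq> {}" using F K(3)[OF that] by auto
        moreover have "subset.chain VV \<F>"
          using F(2) ch unfolding subset.chain_def by blast
        ultimately have "\<Union>\<F> \<in> \<F>"
          using F(1) Union_in_chain by blast
        then show False using F CV that by (auto simp: VV_def)
      qed
      moreover have "openin Z (\<Union>\<C>)" using CV by (auto simp: VV_def)
      moreover obtain V where "V \<in> \<C>" using ne by blast
      then have "U0 \<subseteq> \<Union>\<C>" using CV unfolding VV_def by blast
      ultimately show "\<Union>\<C> \<in> VV" by (simp add: VV_def)
    qed
    then obtain V where V: "V \<in> VV" and Vmax: "\<And>V'. V' \<in> VV \<Longrightarrow> V \<subseteq> V' \<Longrightarrow> V' = V"
      by blast
    have opV: "openin Z V" and UV: "U0 \<subseteq> V" and KV: "\<And>K. K \<in> \<K> \<Longrightarrow> \<not> K \<subseteq> V"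
      using V by (auto simp: VV_def)
    define up where "up C = {z \<in> topspace Z. \<exists>k\<in>C. k \<in> Z closure_of {z}}" for C
    have up_incl: "C \<subseteq> up C" if "C \<subseteq> topspace Z" for C
      using that by (auto simp: up_def in_closure_of)
    have up_cs: "up (K - V) \<in> compact_saturated_sets Z" if "K \<in> \<K>" for K
    proof -
      have "K - V = (topspace Z - V) \<inter> K"
        using K(2)[OF that] BZ by auto
      then have comp: "compactin Z (K - V)"
        using closed_Int_compactin[of Z "topspace Z - V" K] K(1)[OF that] opV by auto
      have KVZ: "K - V \<subseteq> topspace Z" using K(2)[OF that] BZ by auto
      have "compactin Z (up (K - V))"
        unfolding compactin_def
      proof (intro conjI allI impI)
        show "up (K - V) \<subseteq> topspace Z" by (auto simp: up_def)
        fix \<U> assume A: "Ball \<U> (openin Z) \<and> up (K - V) \<subseteq> \<Union>\<U>"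
        then have "K - V \<subseteq> \<Union>\<U>" using up_incl[OF KVZ] by blast
        then obtain \<F> where F: "finite \<F>" "\<F> \<subseteq> \<U>" "K - V \<subseteq> \<Union>\<F>"
          using comp A unfolding compactin_def by meson
        have "up (K - V) \<subseteq> \<Union>\<F>"
        proof
          fix z assume "z \<in> up (K - V)"
          then obtain k where k: "k \<in> K - V" "k \<in> Z closure_of {z}" by (auto simp: up_def)
          then obtain T where "T \<in> \<F>" "k \<in> T" using F by blast
          moreover have "openin Z T" using A F \<open>T \<in> \<F>\<close> by blast
          ultimately show "z \<in> \<Union>\<F>" using k by (auto simp: in_closure_of)
        qed
        then show "\<exists>\<F>. finite \<F> \<and> \<F> \<subseteq> \<U> \<and> up (K - V) \<subseteq> \<Union>\<F>" using F by blast
      qed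
      moreover have "saturatedin Z (up (K - V))"
        unfolding saturatedin_def specialization_le_def up_def
        by (blast intro: closure_of_singleton_trans)
      moreover have "up (K - V) \<noteq> {}"
        using KV[OF that] up_incl[OF KVZ] by blast
      ultimately show ?thesis by (simp add: compact_saturated_sets_def)
    qed
    have up_mono: "up C \<subseteq> up D" if "C \<subseteq> D" for C D
      using that by (auto simp: up_def)
    have upfilt: "filtered_family ((\<lambda>K. up (K - V)) ` \<K>)"
      unfolding filtered_family_def
    proof (intro conjI ballI)
      show "(\<lambda>K. up (K - V)) ` \<K> \<noteq> {}" using filt by (auto simp: filtered_family_def)
      fix L1 L2 assume "L1 \<in> (\<lambda>K. up (K - V)) ` \<K>" "L2 \<in> (\<lambda>K. up (K - V)) ` \<K>"
      then obtain K1 K2 where L: "K1 \<in> \<K>" "K2 \<in> \<K>" "L1 = up (K1 - V)" "L2 = up (K2 - V)"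
        by blast
      then obtain K3 where "K3 \<in> \<K>" "K3 \<subseteq> K1 \<inter> K2"
        using filt unfolding filtered_family_def by meson
      then show "\<exists>L3\<in>(\<lambda>K. up (K - V)) ` \<K>. L3 \<subseteq> L1 \<inter> L2"
        using L up_mono[of "K3 - V" "K1 - V"] up_mono[of "K3 - V" "K2 - V"] by blast
    qed
    have upsub: "(\<lambda>K. up (K - V)) ` \<K> \<subseteq> compact_saturated_sets Z"
      using up_cs by blast
    have upV: "\<not> up (K - V) \<subseteq> V" if "K \<in> \<K>" for K
      using KV[OF that] up_incl[of "K - V"] K(2)[OF that] BZ by blast
    have "\<not> (\<Inter>K\<in>\<K>. up (K - V)) \<subseteq> V"
    proof
      assume "(\<Inter>K\<in>\<K>. up (K - V)) \<subseteq> V"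
      then have "\<exists>L\<in>(\<lambda>K. up (K - V)) ` \<K>. L \<subseteq> V"
        using wf opV upfilt upsub unfolding well_filtered_space_def by blast
      then show False using upV by blast
    qed
    then obtain a where a: "\<And>K. K \<in> \<K> \<Longrightarrow> a \<in> up (K - V)" "a \<notin> V" by blast
    have aZ: "a \<in> topspace Z"
      using a(1) filt by (auto simp: filtered_family_def up_def)
    have Veq: "topspace Z - Z closure_of {a} = V"
    proof (rule Vmax)
      show VV': "V \<subseteq> topspace Z - Z closure_of {a}"
        using opV a(2) openin_subset[OF opV] by (auto simp: in_closure_of)
      have "\<not> K \<subseteq> topspace Z - Z closure_of {a}" if "K \<in> \<K>" for K
        using a(1)[OF that] by (auto simp: up_def)
      then show "topspace Z - Z closure_of {a} \<in> VV"
        using VV' UV by (auto simp: VV_def)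
    qed
    have "a \<in> Z closure_of (B \<inter> Z closure_of {a})"
      unfolding in_closure_of
    proof (intro conjI allI impI aZ)
      fix T assume T: "a \<in> T \<and> openin Z T"
      have "V \<union> T \<notin> VV" using Vmax[of "V \<union> T"] T a(2) by blast
      moreover have "openin Z (V \<union> T)" using opV T by blast
      ultimately obtain K where K': "K \<in> \<K>" "K \<subseteq> V \<union> T"
        using UV by (auto simp: VV_def)
      then obtain k where "k \<in> K" "k \<notin> V" using KV by blast
      then show "\<exists>y. y \<in> B \<inter> Z closure_of {a} \<and> y \<in> T"
        using K' K(2)[OF K'(1)] BZ Veq by blast
    qed
    then have aB: "a \<in> B" by (rule skula)
    have "a \<in> K" if KK: "K \<in> \<K>" for K
    proof -
      obtain k where k: "k \<in> K" "k \<in> Z closure_of {a}" using a(1)[OF KK] by (auto simp: up_def)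
      then have "specialization_le (subtopology Z B) k a"
        using aB K(2)[OF KK] BZ by (auto simp: specialization_le_def closure_of_subtopology)
      then show ?thesis using K(4)[OF KK] k by (auto simp: saturatedin_def)
    qed
    then have "a \<in> U" using sub by blast
    then show False using U0 UV a(2) by blast
  qed
qed

lemma well_filtered_homeomorphic_maps:
  assumes hm: "homeomorphic_maps Z W p q" and wf: "well_filtered_space Z"
  shows "well_filtered_space W"
  unfolding well_filtered_space_def
proof (intro conjI allI impI)
  have cp: "continuous_map Z W p" and cq: "continuous_map W Z q"
    and qp: "\<And>z. z \<in> topspace Z \<Longrightarrow> q (p z) = z" and pq: "\<And>w. w \<in> topspace W \<Longrightarrow> p (q w) = w"
    using hm by (auto simp: homeomorphic_maps_def)
  have "Z homeomorphic_space W" using hm by (auto simp: homeomorphic_space_def)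
  then show "t0_space W"
    using wf homeomorphic_t0_space by (auto simp: well_filtered_space_def)
  fix U \<K>
  assume U: "openin W U" and \<K>: "\<K> \<subseteq> compact_saturated_sets W"
    and filt: "filtered_family \<K>" and sub: "\<Inter>\<K> \<subseteq> U"
  have K: "K \<subseteq> topspace W" "compactin W K" "K \<noteq> {}"
     "\<And>x y. x \<in> K \<Longrightarrow> specialization_le W x y \<Longrightarrow> y \<in> K" if "K \<in> \<K>" for K
    using that \<K> by (auto simp: compact_saturated_sets_def saturatedin_def)
  define U' where "U' = {z \<in> topspace Z. p z \<in> U}"
  have "openin Z U'" unfolding U'_def using cp U by (rule openin_continuous_map_preimage)
  moreover have "(`) q ` \<K> \<subseteq> compact_saturated_sets Z"
  proof clarify
    fix K assume KK: "K \<in> \<K>"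
    have "saturatedin Z (q ` K)"
      unfolding saturatedin_def
    proof (intro conjI allI impI)
      show "q ` K \<subseteq> topspace Z"
        using K(1)[OF KK] cq by (auto simp: continuous_map_def)
      fix x y assume "x \<in> q ` K" and xy: "specialization_le Z x y"
      then obtain k where k: "k \<in> K" "x = q k" by blast
      have "specialization_le W (p x) (p y)"
        unfolding specialization_le_def
      proof (intro conjI)
        show "p x \<in> topspace W" "p y \<in> topspace W"
          using xy cp by (auto simp: specialization_le_def continuous_map_def)
        show "p x \<in> W closure_of {p y}"
          using continuous_map_image_closure_subset[OF cp, of "{y}"] xy
          by (auto simp: specialization_le_def)
      qed
      moreover have "p x \<in> K" using k pq K(1)[OF KK] by auto
      ultimately have "p y \<in> K" using K(4)[OF KK] by blast
      then show "y \<in> q ` K" using qp xy by (metis imageI specialization_le_def)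
    qed
    then show "q ` K \<in> compact_saturated_sets Z"
      using image_compactin[OF K(2)[OF KK] cq] K(3)[OF KK]
      by (auto simp: compact_saturated_sets_def)
  qed
  moreover have "filtered_family ((`) q ` \<K>)"
    unfolding filtered_family_def
  proof (intro conjI ballI)
    show "(`) q ` \<K> \<noteq> {}" using filt by (auto simp: filtered_family_def)
    fix L1 L2 assume "L1 \<in> (`) q ` \<K>" "L2 \<in> (`) q ` \<K>"
    then obtain K1 K2 where L: "K1 \<in> \<K>" "K2 \<in> \<K>" "L1 = q ` K1" "L2 = q ` K2" by blast
    then obtain K3 where "K3 \<in> \<K>" "K3 \<subseteq> K1 \<inter> K2" using filt unfolding filtered_family_def by meson
    then show "\<exists>L3\<in>(`) q ` \<K>. L3 \<subseteq> L1 \<inter> L2" using L by blast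
  qed
  moreover have "\<Inter> ((`) q ` \<K>) \<subseteq> U'"
  proof
    fix z assume z: "z \<in> \<Inter> ((`) q ` \<K>)"
    have *: "z \<in> topspace Z \<and> p z \<in> K" if KK: "K \<in> \<K>" for K
    proof -
      obtain k where "k \<in> K" "z = q k" using z KK by blast
      then show ?thesis using pq K(1)[OF KK] cq by (auto simp: continuous_map_def)
    qed
    moreover have "\<K> \<noteq> {}" using filt unfolding filtered_family_def by meson
    ultimately show "z \<in> U'" using sub by (auto simp: U'_def)
  qed
  ultimately obtain K where KK: "K \<in> \<K>" "q ` K \<subseteq> U'"
    using wf unfolding well_filtered_space_def by (metis (no_types, lifting) imageE)
  then show "\<exists>K\<in>\<K>. K \<subseteq> U"
    using pq K(1)[OF KK(1)] by (intro bexI[of _ K]) (force simp: U'_def)+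
qed

theorem well_filtered_determinedinD:
  fixes X :: "'a topology" and Z :: "'z topology"
  assumes A: "well_filtered_determinedin X A"
    and wf: "well_filtered_space Z" and h: "continuous_map X Z h"
  shows "\<exists>!z. z \<in> topspace Z \<and> Z closure_of (h ` A) = Z closure_of {z}"
proof -
  have t0: "t0_space Z" using wf by (simp add: well_filtered_space_def)
  have hX: "h ` topspace X \<subseteq> topspace Z" using h by (auto simp: continuous_map_def)
  define S where "S = h ` topspace X"
  define B where "B = {z. z \<in> Z closure_of (S \<inter> Z closure_of {z})}"
  have BZ: "B \<subseteq> topspace Z" by (auto simp: B_def in_closure_of)
  have SB: "S \<subseteq> B" using hX by (auto simp: B_def S_def in_closure_of)
  have skula: "z \<in> B" if zcl: "z \<in> Z closure_of (B \<inter> Z closure_of {z})" for z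
    unfolding B_def mem_Collect_eq in_closure_of
  proof (intro conjI allI impI)
    show "z \<in> topspace Z" using zcl by (simp add: in_closure_of)
    fix T assume T: "z \<in> T \<and> openin Z T"
    then obtain b where b: "b \<in> B" "b \<in> Z closure_of {z}" "b \<in> T"
      using zcl unfolding in_closure_of[of z Z "B \<inter> _"] by blast
    then obtain s where "s \<in> S" "s \<in> Z closure_of {b}" "s \<in> T"
      using T unfolding B_def mem_Collect_eq in_closure_of[of b] by blast
    then show "\<exists>y. y \<in> S \<inter> Z closure_of {z} \<and> y \<in> T"
      using closure_of_singleton_trans b(2) by fast
  qed
  define ZB where "ZB = subtopology Z B"
  have wfB: "well_filtered_space ZB"
    unfolding ZB_def using wf BZ skula by (rule well_filtered_subtopology)
  have topB: "topspace ZB = B" using BZ by (auto simp: ZB_def)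
  define e where "e z = {x \<in> topspace X. h x \<in> Z closure_of {z}}" for z
  have cl_e: "Z closure_of {z} = Z closure_of (h ` e z)" if "z \<in> B" for z
  proof -
    have eq: "h ` e z = S \<inter> Z closure_of {z}" by (auto simp: e_def S_def)
    have "{z} \<subseteq> Z closure_of (h ` e z)" using that by (simp add: eq B_def)
    then have "Z closure_of {z} \<subseteq> Z closure_of (h ` e z)"
      by (metis closure_of_closure_of closure_of_mono)
    moreover have "Z closure_of (h ` e z) \<subseteq> Z closure_of {z}"
      by (metis eq Int_lower2 closure_of_closure_of closure_of_mono)
    ultimately show ?thesis by blast
  qed
  have inj: "inj_on e B"
  proof (rule inj_onI)
    fix y z assume "y \<in> B" "z \<in> B" "e y = e z"
    then show "y = z"
      using cl_e[of y] cl_e[of z] t0_space_closure_of_eqD[OF t0] BZ by (metis subsetD)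
  qed
  define d where "d = inv_into B e"
  have de: "d (e z) = z" if "z \<in> B" for z using inj that by (simp add: d_def)
  define W where "W = pullback_topology (e ` B) d ZB"
  have topW: "topspace W = e ` B"
    using de by (auto simp: W_def topspace_pullback_topology topB)
  have ed: "e (d w) = w" if "w \<in> e ` B" for w using that de by auto
  have cd: "continuous_map W ZB d"
    unfolding W_def using continuous_map_pullback[OF continuous_map_id] by simp
  have ce: "continuous_map ZB W e"
    unfolding W_def
  proof (rule continuous_map_pullback')
    have "continuous_map ZB ZB id" by simp
    then show "continuous_map ZB ZB (d \<circ> e)"
      by (rule continuous_map_eq) (simp add: topB de)
    show "topspace ZB \<subseteq> e -` (e ` B)" by (auto simp: topB)
  qed
  have hm: "homeomorphic_maps ZB W e d"
    using cd ce by (auto simp: homeomorphic_maps_def topB topW de)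
  have wfW: "well_filtered_space W"
    using hm wfB by (rule well_filtered_homeomorphic_maps)
  have hB: "continuous_map X ZB h"
    using h SB by (auto simp: ZB_def S_def continuous_map_in_subtopology)
  then have "continuous_map X W (e \<circ> h)" using ce by (rule continuous_map_compose)
  then obtain w where w: "w \<in> topspace W" "W closure_of ((e \<circ> h) ` A) = W closure_of {w}"
    using A wfW unfolding well_filtered_determinedin_def by meson
  have AX: "A \<subseteq> topspace X" using A by (simp add: well_filtered_determinedin_def)
  then have hA: "h ` A \<subseteq> B" using SB by (auto simp: S_def)
  define z where "z = d w"
  have zB: "z \<in> B" using w de by (auto simp: z_def topW)
  have homeo: "homeomorphic_map W ZB d"
    using hm homeomorphic_maps_sym homeomorphic_map_maps by blast
  have "d ` (e \<circ> h) ` A = h ` A"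
  proof -
    have "d ((e \<circ> h) x) = h x" if "x \<in> A" for x using that de hA by auto
    then show ?thesis by (force simp: image_image)
  qed
  then have "ZB closure_of (h ` A) = d ` (W closure_of ((e \<circ> h) ` A))"
    using homeomorphic_map_closure_of[OF homeo, of "(e \<circ> h) ` A"] hA
    by (metis image_comp image_mono topW)
  also have "\<dots> = ZB closure_of {z}"
    using homeomorphic_map_closure_of[OF homeo, of "{w}"] w by (auto simp: z_def)
  finally have "ZB closure_of (h ` A) = ZB closure_of {z}" .
  then have "B \<inter> Z closure_of (h ` A) = B \<inter> Z closure_of {z}"
    using hA zB by (simp add: ZB_def closure_of_subtopology Int_absorb1)
  moreover have "h ` A \<subseteq> Z closure_of (h ` A)" "z \<in> Z closure_of {z}"
    using hA zB BZ by (auto intro!: closure_of_subset) (auto simp: in_closure_of)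
  ultimately have "h ` A \<subseteq> Z closure_of {z}" "{z} \<subseteq> Z closure_of (h ` A)"
    using hA zB by auto
  then have "Z closure_of (h ` A) = Z closure_of {z}"
    by (metis closure_of_closure_of closure_of_mono subset_antisym)
  then show ?thesis
    using zB BZ t0_space_closure_of_eqD[OF t0] by (metis subsetD)
qed

end

theory Submission
  imports Defs
begin

text \<open>
  Let A be irreducible and closed in Y. The closure B of g(A) is irreducible and closed in X,
  hence well-filtered determined. For h from Y to a well-filtered space, h(f(B)) and
  h(f(g(A))) = h(A) have the same closure, so the point that B yields for the composite of h
  and f serves A and h.
\<close>

lemma irreduciblein_continuous_map_image:
  assumes h: "continuous_map X Y h" and A: "irreduciblein X A"
  shows "irreduciblein Y (h ` A)"
  unfolding irreduciblein_def
proof (intro conjI allI impI)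
  have AX: "A \<subseteq> topspace X" using A by (simp add: irreduciblein_def)
  then show "h ` A \<subseteq> topspace Y" using h by (auto simp: continuous_map_def)
  show "h ` A \<noteq> {}" using A by (simp add: irreduciblein_def)
  fix F1 F2 assume F: "closedin Y F1" "closedin Y F2" "h ` A \<subseteq> F1 \<union> F2"
  let ?P = "\<lambda>F. {x \<in> topspace X. h x \<in> F}"
  have "closedin X (?P F1)" "closedin X (?P F2)"
    using F h by (auto intro: closedin_continuous_map_preimage)
  moreover have "A \<subseteq> ?P F1 \<union> ?P F2" using F(3) AX by auto
  ultimately have "A \<subseteq> ?P F1 \<or> A \<subseteq> ?P F2" using A unfolding irreduciblein_def by blast
  then show "h ` A \<subseteq> F1 \<or> h ` A \<subseteq> F2" by blast
qed

text \<open>A closed set that contains \<open>A\<close> already contains its closure, so a closed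
  piece that covers \<open>A\<close> covers the closure as well.\<close>

lemma irreduciblein_closure_of:
  assumes A: "irreduciblein X A"
  shows "irreduciblein X (X closure_of A)"
  unfolding irreduciblein_def
proof (intro conjI allI impI)
  have sub: "A \<subseteq> X closure_of A" using A by (simp add: irreduciblein_def closure_of_subset)
  show "X closure_of A \<subseteq> topspace X" by (rule closure_of_subset_topspace)
  show "X closure_of A \<noteq> {}" using A sub by (auto simp: irreduciblein_def)
  fix F1 F2 assume F: "closedin X F1" "closedin X F2" "X closure_of A \<subseteq> F1 \<union> F2"
  then have "A \<subseteq> F1 \<or> A \<subseteq> F2" using A sub unfolding irreduciblein_def by blast
  then show "X closure_of A \<subseteq> F1 \<or> X closure_of A \<subseteq> F2"
    using F closure_of_minimal by metis
qed

lemma closure_of_image_closure_of: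
  assumes h: "continuous_map X Y h" and A: "A \<subseteq> topspace X"
  shows "Y closure_of (h ` (X closure_of A)) = Y closure_of (h ` A)"
proof
  show "Y closure_of (h ` (X closure_of A)) \<subseteq> Y closure_of (h ` A)"
    using continuous_map_image_closure_subset[OF h] by (simp add: closure_of_minimal)
  show "Y closure_of (h ` A) \<subseteq> Y closure_of (h ` (X closure_of A))"
    using A by (intro closure_of_mono image_mono closure_of_subset)
qed

theorem proposition6p24:
  fixes X :: "'a topology" and Y :: "'b topology"
    and f :: "'a \<Rightarrow> 'b" and g :: "'b \<Rightarrow> 'a"
  assumes "t0_space X" and "well_filtered_determined_space X"
    and "t0_space Y"
    and "continuous_map X Y f" and "continuous_map Y X g"
    and "\<forall>y\<in>topspace Y. (f \<circ> g) y = y"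
  shows "well_filtered_determined_space Y"
  unfolding well_filtered_determined_space_def
proof (intro conjI allI impI)
  show "t0_space Y" by fact
  fix A assume A: "irreduciblein Y A"
  then have AY: "A \<subseteq> topspace Y" by (simp add: irreduciblein_def)
  have gA: "irreduciblein X (g ` A)"
    using assms(5) A by (rule irreduciblein_continuous_map_image)
  then have gAX: "g ` A \<subseteq> topspace X" by (simp add: irreduciblein_def)
  define B where "B = X closure_of (g ` A)"
  have B: "well_filtered_determinedin X B"
    using assms(2) irreduciblein_closure_of[OF gA]
    by (simp add: B_def well_filtered_determined_space_def)
  show "well_filtered_determinedin Y A"
    unfolding well_filtered_determinedin_def
  proof (intro conjI allI impI AY)
    fix Z :: "'b set topology" and h
    assume Z: "well_filtered_space Z" and h: "continuous_map Y Z h"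
    have hf: "continuous_map X Z (h \<circ> f)" using assms(4) h by (rule continuous_map_compose)
    \<comment> \<open>The retraction identity cancels \<open>f\<close> against \<open>g\<close> at
      the points of \<open>A\<close>, all of which lie in \<open>Y\<close>.\<close>
    have "(h \<circ> f) ` g ` A = h ` A"
      unfolding image_image using AY assms(6) by (intro image_cong) auto
    then have "Z closure_of ((h \<circ> f) ` B) = Z closure_of (h ` A)"
      using closure_of_image_closure_of[OF hf gAX] by (simp add: B_def)
    \<comment> \<open>\<open>Z\<close> has points of type \<open>'b set\<close>, whereas the
      definition tests \<open>B\<close> only on spaces over \<open>'a set\<close>;
      \<open>well_filtered_determinedinD\<close> bridges the two types.\<close>
    then show "\<exists>!z. z \<in> topspace Z \<and> Z closure_of (h ` A) = Z closure_of {z}"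
      using well_filtered_determinedinD[OF B Z hf] by simp
  qed
qed

end
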